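(* Let $d \ge 1$, let $F$ be a finite subset of $\mathbb{Z}^d$ with $0 \in F$, and let $A \subset \mathbb{Z}^d$ be a set such that $\mathbf{1}_F * \mathbf{1}_A$ is $\ell\mathbb{Z}^d$-periodic for some integer $\ell \ge 1$. Let $q$ be the least common multiple of $\ell$ and all the primes less than or equal to $2|F|$. Then there exist functions $\varphi_f : \mathbb{Z}^d \to [0,1]$ for $f \in F \setminus \{0\}$ such that $$\mathbf{1}_A = \mathbf{1}_F * \mathbf{1}_A - \sum_{f \in F \setminus \{0\}} \varphi_f$$ and, for each $f \in F \setminus \{0\}$, $\varphi_f$ is $\langle q f \rangle$-periodic.
   Context: $\mathbf{1}_S$ is the indicator function of $S$; $f*g(x) = \sum_{y \in \mathbb{Z}^d} f(y)g(x-y)$. A function $g:\mathbb{Z}^d\to\mathbb{R}$ is $\Gamma$-periodic, for a subgroup $\Gamma \le \mathbb{Z}^d$, if $g(x+\gamma) = g(x)$ for all $x\in\mathbb{Z}^d$, $\gamma \in \Gamma$. $\langle h \rangle = \{nh : n \in \mathbb{Z}\}$. *)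

theory Defs
  imports "HOL-Analysis.Analysis" "HOL-Computational_Algebra.Primes"
begin

text \<open>The lattice \<open>\<int>\<^sup>d\<close> is the type \<^typ>\<open>int ^ 'd\<close> with \<open>'d\<close> finite, so that
  \<open>d = CARD('d) \<ge> 1\<close> holds automatically; \<open>*s\<close> is multiplication by integers.\<close>

text \<open>\<open>infsum\<close> is 0 for sums that do not converge absolutely; when \<open>f\<close> has finite support
  it is the ordinary finite sum.\<close>

definition convolution ::
  "(int ^ 'd \<Rightarrow> real) \<Rightarrow> (int ^ 'd \<Rightarrow> real) \<Rightarrow> int ^ 'd \<Rightarrow> real"
  (infixl "\<star>" 70)
  where "(f \<star> g) x = (\<Sum>\<^sub>\<infinity>y\<in>UNIV. f y * g (x - y))"

text \<open>Only used when \<open>\<Gamma>\<close> is a subgroup.\<close>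

definition periodic :: "(int ^ 'd) set \<Rightarrow> (int ^ 'd \<Rightarrow> real) \<Rightarrow> bool"
  where "periodic \<Gamma> g \<longleftrightarrow> (\<forall>x. \<forall>\<gamma>\<in>\<Gamma>. g (x + \<gamma>) = g x)"

definition scaled_lattice :: "int \<Rightarrow> (int ^ 'd) set"
  where "scaled_lattice l = range (\<lambda>v. l *s v)"

definition cyclic_subgroup :: "int ^ 'd \<Rightarrow> (int ^ 'd) set"
  where "cyclic_subgroup h = {n *s h | n. True}"

end

theory Submission
  imports Defs "HOL-Library.Poly_Mapping"
begin

text \<open>
  Write \<open>G r x = (\<Sum>f\<in>F. 1\<^sub>A (x - r f))\<close>, so that \<open>G 1\<close> is the given periodic function
  \<open>g = 1\<^sub>F * 1\<^sub>A\<close>. The heart of the matter is that \<open>G r = g\<close> for every \<open>r = 1 + q n\<close>: dilating \<open>F\<close>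
  by \<open>r\<close> does not change the convolution. Since \<open>0 \<in> F\<close>, this says
  \<open>1\<^sub>A x = g x - (\<Sum>f\<in>F-{0}. 1\<^sub>A (x - (1 + q n) f))\<close> for all \<open>n \<ge> 0\<close>.
  Averaging over \<open>n \<le> m\<close> and letting \<open>m\<close> tend to infinity along a suitable filter replaces the
  term of \<open>f\<close> by a function \<open>\<phi>\<^sub>f\<close> with values in \<open>[0,1]\<close>. Translation by \<open>q f\<close> moves the index \<open>n\<close> by
  one, which changes the averages by \<open>O(1/m)\<close>, so \<open>\<phi>\<^sub>f\<close> is invariant under it.

  The invariance under dilation has two independent sources.

  \<^item> Arithmetic (\<open>dilated_sum_periodic\<close>): in the group ring of \<open>\<int>\<^sup>d\<close>, the Frobenius congruence says that
    dilating \<open>1\<^sub>F\<close> by a prime \<open>p\<close> agrees modulo \<open>p\<close> with taking its \<open>p\<close>-th convolution power. Hence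
    \<open>G p\<close> is congruent modulo \<open>p\<close> to the convolution of \<open>g\<close> with the \<open>(p-1)\<close>-st power of \<open>1\<^sub>F\<close>, which
    inherits every period of \<open>g\<close>. As \<open>G p\<close> takes values in \<open>{0..|F|}\<close>, for \<open>p > |F|\<close> it is
    itself periodic. Iterating over the prime factors of \<open>r\<close>, which cannot be small because \<open>r\<close> is
    \<open>1\<close> modulo all small primes, shows that \<open>G r\<close> has the same periods \<open>l \<int>\<^sup>d\<close> as \<open>g\<close>.

  \<^item> Averaging (\<open>invariant_sum_of_coboundaries_le\<close>): the two sides of \<open>G r = g\<close> differ by a sum over
    \<open>f\<close> of differences between a bounded function and its translate by \<open>(r - 1) f \<in> l \<int>\<^sup>d\<close>. Such
    a sum has mean zero along \<open>l \<int>\<^sup>d\<close>; being \<open>l \<int>\<^sup>d\<close>-periodic, it vanishes.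
\<close>

section \<open>Convolution by elements of a group ring\<close>

text \<open>The group ring of an abelian group over the integers is the type of finitely supported
  functions with convolution as product. It acts on arbitrary integer-valued functions by
  convolution; that this is a ring action is what allows one to compute with powers of \<open>1\<^sub>F\<close> while
  \<open>1\<^sub>A\<close> has infinite support.\<close>

definition act :: "('g::ab_group_add \<Rightarrow>\<^sub>0 int) \<Rightarrow> ('g \<Rightarrow> int) \<Rightarrow> 'g \<Rightarrow> int"
  where "act P u x = (\<Sum>k\<in>Poly_Mapping.keys P. Poly_Mapping.lookup P k * u (x - k))"

lemma act_add: "act (P + Q) u x = act P u x + act Q u x"
  unfolding act_def
  by (rule setsum_keys_plus_distrib) (auto simp: algebra_simps)

lemma act_zero [simp]: "act 0 u x = 0"
  by (simp add: act_def)

lemma act_sum: "act (\<Sum>i\<in>I. P i) u x = (\<Sum>i\<in>I. act (P i) u x)"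
  by (induction I rule: infinite_finite_induct) (auto simp: act_add)

lemma act_single: "act (Poly_Mapping.single k c) u x = c * u (x - k)"
  by (simp add: act_def)

lemma sum_single_lookup:
  "(\<Sum>k\<in>Poly_Mapping.keys P. Poly_Mapping.single k (Poly_Mapping.lookup P k)) = P"
  by (rule poly_mapping_eqI)
     (auto simp: lookup_sum lookup_single when_def in_keys_iff)

lemma act_mult: "act (P * Q) u = act P (act Q u)"
proof
  fix x
  let ?s = "Poly_Mapping.single" and ?l = "Poly_Mapping.lookup" and ?K = "Poly_Mapping.keys"
  have "P * Q = (\<Sum>k\<in>?K P. ?s k (?l P k)) * (\<Sum>j\<in>?K Q. ?s j (?l Q j))"
    by (simp only: sum_single_lookup)
  also have "\<dots> = (\<Sum>k\<in>?K P. \<Sum>j\<in>?K Q. ?s (k + j) (?l P k * ?l Q j))"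
    by (simp add: sum_product mult_single)
  finally have "act (P * Q) u x = (\<Sum>k\<in>?K P. \<Sum>j\<in>?K Q. ?l P k * ?l Q j * u (x - (k + j)))"
    by (simp add: act_sum act_single)
  also have "\<dots> = act P (act Q u) x"
    by (simp add: act_def sum_distrib_left mult.assoc diff_diff_eq)
  finally show "act (P * Q) u x = act P (act Q u) x" .
qed

lemma act_of_nat_mult: "act (of_nat n * P) u x = int n * act P u x"
proof -
  have "act (of_nat n) v x = int n * v x" for v :: "'a \<Rightarrow> int"
    using act_single[of 0 "int n" v x] by simp
  thus ?thesis by (simp add: act_mult)
qed

lemma act_periodic:
  assumes "\<And>x. u (x + t) = u x"
  shows "act P u (x + t) = act P u x"
  unfolding act_def by (simp add: assms diff_add_eq[symmetric])

section \<open>The Frobenius congruence and dilations\<close>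

text \<open>The usual Frobenius identity, stated as divisibility by \<open>p\<close> because the group ring in
  question has characteristic 0.\<close>

lemma prime_dvd_power_add_diff:
  fixes a b :: "'a::comm_ring_1"
  assumes "prime p"
  shows "of_nat p dvd (a + b) ^ p - (a ^ p + b ^ p)"
proof -
  have "p > 0" using assms by (rule prime_gt_0_nat)
  let ?g = "\<lambda>k. of_nat (p choose k) * a ^ k * b ^ (p - k)"
  have "(a + b) ^ p = (\<Sum>k\<le>p. ?g k)"
    by (rule binomial_ring)
  also have "\<dots> = (\<Sum>k\<in>{0,p}. ?g k) + (\<Sum>k\<in>{..p}-{0,p}. ?g k)"
    by (subst sum.subset_diff[of "{0,p}"]) (auto simp: add.commute)
  also have "(\<Sum>k\<in>{0,p}. ?g k) = a ^ p + b ^ p"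
    using \<open>p > 0\<close> by simp
  finally have eq: "(a + b) ^ p - (a ^ p + b ^ p) = (\<Sum>k\<in>{..p}-{0,p}. ?g k)"
    by simp
  have "of_nat p dvd ?g k" if "k \<in> {..p}-{0,p}" for k
  proof -
    have "p dvd (p choose k)"
      by (rule dvd_choose_prime) (use that assms in auto)
    then obtain m where "p choose k = p * m" by (elim dvdE)
    thus ?thesis by (simp add: mult.assoc)
  qed
  thus ?thesis unfolding eq by (intro dvd_sum) auto
qed

lemma prime_dvd_power_sum_diff:
  fixes a :: "'i \<Rightarrow> 'a::comm_ring_1"
  assumes "prime p" "finite I"
  shows "of_nat p dvd (\<Sum>i\<in>I. a i) ^ p - (\<Sum>i\<in>I. a i ^ p)"
  using assms(2)
proof induction
  case empty
  thus ?case using prime_gt_0_nat[OF assms(1)] by (simp add: power_0_left)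
next
  case (insert j I)
  let ?s = "\<Sum>i\<in>I. a i" and ?t = "\<Sum>i\<in>I. a i ^ p"
  have "of_nat p dvd ((a j + ?s) ^ p - (a j ^ p + ?s ^ p)) + (?s ^ p - ?t)"
    using prime_dvd_power_add_diff[OF assms(1)] insert.IH by (rule dvd_add)
  also have "\<dots> = (a j + ?s) ^ p - (a j ^ p + ?t)"
    by simp
  finally show ?case using insert.hyps by simp
qed

lemma single_power:
  fixes k :: "int ^ 'd"
  shows "Poly_Mapping.single k (1::int) ^ n = Poly_Mapping.single (int n *s k) 1"
  by (induction n) (auto simp: mult_single vector_sadd_rdistrib)

text \<open>The \<open>p\<close>-th power of the basis element at \<open>t\<close> is the basis element at \<open>p t\<close>, so on sums of
  basis elements Frobenius is dilation by \<open>p\<close>, modulo \<open>p\<close>.\<close>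

lemma dilated_sum_cong_act_power:
  fixes u :: "int ^ 'd \<Rightarrow> int" and t :: "'i \<Rightarrow> int ^ 'd"
  assumes "prime p" "finite I"
  shows "int p dvd act ((\<Sum>i\<in>I. Poly_Mapping.single (t i) 1) ^ p) u x
                   - (\<Sum>i\<in>I. u (x - int p *s t i))"
proof -
  let ?P = "\<Sum>i\<in>I. Poly_Mapping.single (t i) (1::int)"
  let ?P' = "\<Sum>i\<in>I. Poly_Mapping.single (int p *s t i) (1::int)"
  obtain R where R: "?P ^ p - ?P' = of_nat p * R"
    using prime_dvd_power_sum_diff[OF assms, of "\<lambda>i. Poly_Mapping.single (t i) (1::int)"]
    by (auto simp: single_power elim: dvdE)
  hence "?P ^ p = of_nat p * R + ?P'" by (simp add: algebra_simps)
  thus ?thesis by (simp add: act_add act_of_nat_mult act_sum act_single)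
qed

text \<open>One prime factor is added to the dilation at a time. Modulo \<open>p\<close>, the sum dilated by \<open>p r\<close> is the
  image of the periodic sum dilated by \<open>r\<close> under a group ring element, hence periodic; a congruence
  modulo \<open>p\<close> between numbers in \<open>{0..card F}\<close> is an equality once \<open>p > card F\<close>.\<close>

lemma dilated_sum_periodic:
  fixes F A :: "(int ^ 'd) set" and \<gamma> :: "int ^ 'd"
  defines "G \<equiv> \<lambda>r x. \<Sum>f\<in>F. (of_bool (x - int r *s f \<in> A) :: int)"
  assumes "finite F" and base: "\<And>x. G 1 (x + \<gamma>) = G 1 x"
    and "r > 0" and "\<And>p. prime p \<Longrightarrow> p dvd r \<Longrightarrow> p > card F"
  shows "G r (x + \<gamma>) = G r x"
  using assms(4,5)
proof (induction r arbitrary: x rule: prime_divisors_induct)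
  case zero
  thus ?case by simp
next
  case (unit r)
  thus ?case using base by simp
next
  case (factor p r)
  let ?u = "\<lambda>x. of_bool (x \<in> A) :: int"
  let ?P = "\<Sum>f\<in>F. Poly_Mapping.single (int r *s f) (1::int)"
  have p: "prime p" "p > card F" using factor by auto
  have G: "act ?P ?u = G r"
    by (rule ext) (simp add: act_sum act_single G_def)
  have IH: "G r (y + \<gamma>) = G r y" for y
    using factor.IH factor.prems by auto
  have cong: "int p dvd act (?P ^ p) ?u y - G (p * r) y" for y
    using dilated_sum_cong_act_power[OF p(1) \<open>finite F\<close>, of "\<lambda>f. int r *s f" ?u y]
    by (simp add: G_def)
  have "?P ^ p = ?P ^ (p - 1) * ?P"
    using prime_gt_0_nat[OF p(1)] by (metis power_minus_mult)
  hence "act (?P ^ p) ?u = act (?P ^ (p - 1)) (G r)"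
    by (simp only: act_mult G)
  hence "act (?P ^ p) ?u (x + \<gamma>) = act (?P ^ p) ?u x"
    using act_periodic[of "G r" \<gamma>, OF IH] by simp
  with dvd_diff[OF cong[of x] cong[of "x + \<gamma>"]]
  have dvd: "int p dvd G (p * r) (x + \<gamma>) - G (p * r) x"
    by (simp add: algebra_simps)
  have bounds: "0 \<le> G s y \<and> G s y \<le> int (card F)" for s y
    using sum_bounded_above[of F "\<lambda>f. ?u (y - int s *s f)" 1]
    by (auto simp: G_def intro!: sum_nonneg)
  have "\<bar>G (p * r) (x + \<gamma>) - G (p * r) x\<bar> < int p"
    using bounds[of "p * r" x] bounds[of "p * r" "x + \<gamma>"] p(2) by linarith
  with dvd show ?case
    using dvd_imp_le_int[of "G (p * r) (x + \<gamma>) - G (p * r) x" "int p"] by force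
qed

section \<open>Invariant sums of coboundaries\<close>

text \<open>An invariant function that is within \<open>e\<close> of a sum of coboundaries is bounded by \<open>e\<close>, because
  coboundaries have mean zero. The averaging is done one map at a time: averaging over the first
  \<open>m + 1\<close> iterates of \<open>T j\<close> fixes \<open>h\<close>, turns the coboundary of \<open>T j\<close> into a telescoping sum of size at most
  \<open>2 C / (m + 1)\<close>, and keeps the other coboundaries of the same shape since the maps commute. The
  slack \<open>e\<close> absorbs this error in the induction; only \<open>e = 0\<close> is of interest in the end.\<close>

lemma invariant_sum_of_coboundaries_le:
  fixes h :: "'a \<Rightarrow> real" and T :: "'i \<Rightarrow> 'a \<Rightarrow> 'a" and u :: "'i \<Rightarrow> 'a \<Rightarrow> real"
  assumes "finite I"
    and "\<And>i j x. i \<in> I \<Longrightarrow> j \<in> I \<Longrightarrow> T i (T j x) = T j (T i x)"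
    and "\<And>i x. i \<in> I \<Longrightarrow> h (T i x) = h x"
    and "\<And>i x. i \<in> I \<Longrightarrow> \<bar>u i x\<bar> \<le> C"
    and "\<And>x. \<bar>h x - (\<Sum>i\<in>I. u i (T i x) - u i x)\<bar> \<le> e"
  shows "\<bar>h x\<bar> \<le> e"
  using assms
proof (induction I arbitrary: u e x rule: finite_induct)
  case empty
  thus ?case by simp
next
  case (insert j I)
  let ?y = "\<lambda>n x. (T j ^^ n) x"
  have le: "\<bar>h x\<bar> \<le> e + 2 * C / real (Suc m)" for m x
  proof -
    let ?N = "real (Suc m)"
    define v where "v = (\<lambda>i x. (\<Sum>n\<le>m. u i (?y n x)) / ?N)"
    have h_iter: "h (?y n z) = h z" for n z
      by (induction n) (auto simp: insert.prems)
    have comm: "T i (?y n z) = ?y n (T i z)" if "i \<in> I" for i n z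
      using insert.prems(1)[of i j] that by (induction n) simp_all
    show ?thesis
    proof (rule insert.IH)
      show "T i (T k z) = T k (T i z)" if "i \<in> I" "k \<in> I" for i k z
        using insert.prems(1) that by blast
      show "h (T i z) = h z" if "i \<in> I" for i z
        using insert.prems(2) that by blast
      show "\<bar>v i z\<bar> \<le> C" if "i \<in> I" for i z
      proof -
        have "\<bar>\<Sum>n\<le>m. u i (?y n z)\<bar> \<le> (\<Sum>n\<le>m. C)"
          by (rule order.trans[OF sum_abs], rule sum_mono) (use insert.prems(3) that in auto)
        thus ?thesis by (simp add: v_def abs_divide field_simps)
      qed
    next
      fix z
      let ?E = "\<lambda>w. h w - (\<Sum>i\<in>insert j I. u i (T i w) - u i w)"
      \<comment> \<open>\<open>?E\<close> is the error of the approximation by all coboundaries, which the hypothesis bounds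
        by \<open>e\<close>; at each point of the orbit only the coboundary of \<open>T j\<close> is left over.\<close>
      have step: "h z - (\<Sum>i\<in>I. u i (?y n (T i z)) - u i (?y n z))
          = ?E (?y n z) + (u j (?y (Suc n) z) - u j (?y n z))" for n
        using insert.hyps by (simp add: h_iter comm cong: sum.cong)
      have "?N * (h z - (\<Sum>i\<in>I. v i (T i z) - v i z))
          = (\<Sum>n\<le>m. h z - (\<Sum>i\<in>I. u i (?y n (T i z)) - u i (?y n z)))"
      proof -
        have "?N * (\<Sum>i\<in>I. v i (T i z) - v i z)
            = (\<Sum>i\<in>I. \<Sum>n\<le>m. u i (?y n (T i z)) - u i (?y n z))"
          unfolding sum_distrib_left
          by (intro sum.cong refl) (simp add: v_def sum_subtractf diff_divide_distrib[symmetric])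
        also have "\<dots> = (\<Sum>n\<le>m. \<Sum>i\<in>I. u i (?y n (T i z)) - u i (?y n z))"
          by (rule sum.swap)
        finally show ?thesis by (simp add: right_diff_distrib sum_subtractf)
      qed
      also have "\<dots> = (\<Sum>n\<le>m. ?E (?y n z)) + (\<Sum>n\<le>m. u j (?y (Suc n) z) - u j (?y n z))"
        by (simp only: step sum.distrib)
      also have "(\<Sum>n\<le>m. u j (?y (Suc n) z) - u j (?y n z)) = u j (?y (Suc m) z) - u j z"
        by (induction m) auto
      finally have eq: "?N * (h z - (\<Sum>i\<in>I. v i (T i z) - v i z))
          = (\<Sum>n\<le>m. ?E (?y n z)) + (u j (?y (Suc m) z) - u j z)" .
      have "\<bar>\<Sum>n\<le>m. ?E (?y n z)\<bar> \<le> (\<Sum>n\<le>m. e)"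
        by (rule order.trans[OF sum_abs], rule sum_mono) (rule insert.prems(4))
      moreover have "\<bar>u j (?y (Suc m) z) - u j z\<bar> \<le> 2 * C"
        using insert.prems(3)[of j "?y (Suc m) z"] insert.prems(3)[of j z] by simp
      ultimately have "\<bar>?N * (h z - (\<Sum>i\<in>I. v i (T i z) - v i z))\<bar> \<le> ?N * e + 2 * C"
        unfolding eq by simp
      hence "?N * \<bar>h z - (\<Sum>i\<in>I. v i (T i z) - v i z)\<bar> \<le> ?N * e + 2 * C"
        by (simp only: abs_mult abs_of_nat)
      thus "\<bar>h z - (\<Sum>i\<in>I. v i (T i z) - v i z)\<bar> \<le> e + 2 * C / ?N"
        by (simp add: field_simps)
    qed
  qed
  have "(\<lambda>m. e + 2 * C / real (Suc m)) \<longlonglongrightarrow> e + 0"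
    by (intro tendsto_intros LIMSEQ_Suc[OF lim_const_over_n])
  thus ?case
    using le by (intro LIMSEQ_le_const[of "\<lambda>m. e + 2 * C / real (Suc m)"]) auto
qed

section \<open>Dilation invariance of periodic tilings\<close>

text \<open>The difference \<open>G r - G 1\<close> is a sum of coboundaries for the translations by \<open>-(r - 1) f\<close>, where
  \<open>f\<close> ranges over \<open>F\<close>. Since \<open>l\<close> divides \<open>r - 1\<close>, it is also invariant under them, and therefore zero.\<close>

lemma dilated_sum_eq:
  fixes F A :: "(int ^ 'd) set" and l :: int
  defines "G \<equiv> \<lambda>r x. \<Sum>f\<in>F. (of_bool (x - int r *s f \<in> A) :: int)"
  assumes "finite F" and base: "\<And>x v. G 1 (x + l *s v) = G 1 x"
    and "r > 0" and "\<And>p. prime p \<Longrightarrow> p dvd r \<Longrightarrow> p > card F"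
    and "l dvd int r - 1"
  shows "G r x = G 1 x"
proof -
  obtain c where c: "int r - 1 = l * c" using \<open>l dvd int r - 1\<close> by (elim dvdE)
  have periodic_r: "G r (x + l *s v) = G r x" for x v
    unfolding G_def
    by (rule dilated_sum_periodic) (use assms in \<open>auto simp: G_def\<close>)
  define h where "h = (\<lambda>x. real_of_int (G r x - G 1 x))"
  define u where "u = (\<lambda>f x. of_bool (x - f \<in> A) :: real)"
  define T where "T = (\<lambda>f x. x + l *s (- c *s f) :: int ^ 'd)"
  have T: "T f x - f = x - int r *s f" for f x
  proof -
    have "int r = 1 + l * c" using c by simp
    thus ?thesis by (simp add: T_def vec_eq_iff algebra_simps)
  qed
  have "\<bar>h x\<bar> \<le> 0"
  proof (rule invariant_sum_of_coboundaries_le[where I = F and T = T and u = u and C = 1])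
    show "h (T f x) = h x" for f x
      by (simp only: h_def T_def periodic_r base)
    show "\<bar>h x - (\<Sum>f\<in>F. u f (T f x) - u f x)\<bar> \<le> 0" for x
      by (simp add: h_def u_def T G_def sum_subtractf)
  qed (use \<open>finite F\<close> in \<open>auto simp: T_def u_def\<close>)
  thus ?thesis by (simp add: h_def)
qed

section \<open>Simultaneous generalized limits\<close>

text \<open>By compactness of the cube \<open>[0,1]\<^sup>I\<close> the sequence of points \<open>a n\<close> has a cluster point, and a
  cluster point is a limit along a filter finer than the sequential one. A single filter serves
  all coordinates, so linear relations between the coordinates survive in the limit.\<close>

lemma simultaneous_limit_along_filter:
  fixes a :: "nat \<Rightarrow> 'i \<Rightarrow> real"
  assumes "\<And>n i. a n i \<in> {0..1}"
  obtains \<U> L where "\<U> \<noteq> bot" "\<U> \<le> sequentially"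
    "\<And>i. L i \<in> {0..1}" "\<And>i. ((\<lambda>n. a n i) \<longlongrightarrow> L i) \<U>"
proof -
  let ?K = "PiE UNIV (\<lambda>_::'i. {0..1::real})"
  have "compactin (product_topology (\<lambda>_. euclidean) UNIV) ?K"
    by (simp add: compactin_PiE)
  hence "compact ?K"
    by (simp add: euclidean_product_topology)
  moreover have "filtermap a sequentially \<noteq> bot"
    by (simp add: filtermap_bot_iff)
  moreover have "eventually (\<lambda>y. y \<in> ?K) (filtermap a sequentially)"
    using assms by (simp add: eventually_filtermap PiE_def)
  ultimately obtain L where L: "L \<in> ?K" "inf (nhds L) (filtermap a sequentially) \<noteq> bot"
    unfolding compact_filter by blast
  define \<U> where "\<U> = inf (filtercomap a (nhds L)) sequentially"
  have "\<U> \<noteq> bot"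
  proof
    assume "\<U> = bot"
    hence "eventually (\<lambda>_. False) \<U>" by simp
    then obtain P Q where "eventually P (nhds L)" "eventually Q sequentially"
      "\<And>n. P (a n) \<Longrightarrow> Q n \<Longrightarrow> False"
      unfolding \<U>_def eventually_inf eventually_filtercomap by metis
    hence "eventually (\<lambda>y. \<not> P y) (filtermap a sequentially)"
      unfolding eventually_filtermap by (auto elim!: eventually_mono)
    with \<open>eventually P (nhds L)\<close> have "eventually (\<lambda>_. False) (inf (nhds L) (filtermap a sequentially))"
      unfolding eventually_inf by blast
    with L(2) show False by (simp add: trivial_limit_def)
  qed
  moreover have "\<U> \<le> sequentially" by (simp add: \<U>_def)
  moreover have "L i \<in> {0..1}" for i using L(1) by (auto simp: PiE_def Pi_def)
  moreover have "((\<lambda>n. a n i) \<longlongrightarrow> L i) \<U>" for i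
  proof -
    have "(a \<longlongrightarrow> L) \<U>"
      by (rule filterlim_mono[OF filterlim_filtercomap order_refl]) (simp add: \<U>_def)
    from continuous_on_tendsto_compose[OF continuous_on_product_coordinates this, of i]
    show ?thesis by simp
  qed
  ultimately show ?thesis using that by blast
qed

section \<open>The structure theorem\<close>

lemma indicator_convolution_indicator:
  assumes "finite F"
  shows "(indicator F \<star> indicator A) x = (\<Sum>f\<in>F. of_bool (x - f \<in> A))"
proof -
  have "(indicator F \<star> indicator A) x
      = infsum (\<lambda>y. indicator F y * (indicator A (x - y) :: real)) F"
    unfolding convolution_def by (rule infsum_cong_neutral) auto
  thus ?thesis using assms by (simp add: indicator_def of_bool_def)
qed

lemma periodic_cyclic_subgroupI:
  assumes "\<And>x. g (x + h) = g x"
  shows "periodic (cyclic_subgroup h) g"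
proof -
  have "g (x + n *s h) = g x" for n x
  proof (induction n rule: int_induct[where k = 0])
    case base
    thus ?case by simp
  next
    case (step1 i)
    thus ?case using assms[of "x + i *s h"] by (simp add: vector_sadd_rdistrib add.assoc)
  next
    case (step2 i)
    thus ?case using assms[of "x + (i - 1) *s h"]
      by (simp add: vec_eq_iff algebra_simps vector_ssub_ldistrib)
  qed
  thus ?thesis by (auto simp: periodic_def cyclic_subgroup_def)
qed

theorem theorem1p7:
  fixes F A :: "(int ^ 'd) set" and l q :: nat
  assumes "finite F" and "0 \<in> F"
    and "l \<ge> 1"
    and "periodic (scaled_lattice (int l)) (indicator F \<star> indicator A)"
    and "q = Lcm (insert l {p. prime p \<and> p \<le> 2 * card F})"
  shows "\<exists>\<phi> :: int ^ 'd \<Rightarrow> int ^ 'd \<Rightarrow> real.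
    (\<forall>f\<in>F - {0}. \<forall>x. \<phi> f x \<in> {0..1}) \<and>
    (\<forall>x. indicator A x = (indicator F \<star> indicator A) x - (\<Sum>f\<in>F - {0}. \<phi> f x)) \<and>
    (\<forall>f\<in>F - {0}. periodic (cyclic_subgroup (int q *s f)) (\<phi> f))"
proof -
  let ?g = "indicator F \<star> (indicator A :: int ^ 'd \<Rightarrow> real)"
  define G where "G = (\<lambda>r x. \<Sum>f\<in>F. (of_bool (x - int r *s f \<in> A) :: int))"
  have g: "?g x = real_of_int (G 1 x)" for x
    using \<open>finite F\<close> by (simp add: G_def indicator_convolution_indicator)
  have base: "G 1 (x + int l *s v) = G 1 x" for x v
    using assms(4) by (simp add: periodic_def scaled_lattice_def g)
  have dilate: "G (1 + q * n) x = G 1 x" for n x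
    unfolding G_def
  proof (rule dilated_sum_eq[where l = "int l"])
    show "p > card F" if "prime p" "p dvd 1 + q * n" for p
    proof (rule ccontr)
      assume "\<not> p > card F"
      hence "p dvd q" using \<open>prime p\<close> assms(5) by (auto intro!: dvd_Lcm)
      hence "p dvd 1" using that(2) by (metis dvd_add_left_iff dvd_mult2)
      thus False using \<open>prime p\<close> by simp
    qed
    have "l dvd q" using assms(5) by (auto intro!: dvd_Lcm)
    thus "int l dvd int (1 + q * n) - 1" by simp
  qed (use \<open>finite F\<close> base in \<open>auto simp: G_def\<close>)

  define \<alpha> where "\<alpha> = (\<lambda>x. of_bool (x \<in> A) :: real)"
  \<comment> \<open>Averages over \<open>m + 1\<close> dilations; the pair \<open>(f, x)\<close> is one index, so that one limit handles
    all \<open>f\<close> and \<open>x\<close> together.\<close>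
  define a where "a = (\<lambda>m (f, x). (\<Sum>n\<le>m. \<alpha> (x - int (1 + q * n) *s f)) / real (Suc m))"
  have sum_\<alpha>: "(\<Sum>f\<in>F - {0}. \<alpha> (x - int (1 + q * n) *s f)) = ?g x - indicator A x" for n x
  proof -
    have "?g x = (\<Sum>f\<in>F. \<alpha> (x - int (1 + q * n) *s f))"
      unfolding g dilate[of n, symmetric] by (simp add: G_def \<alpha>_def)
    also have "\<dots> = \<alpha> x + (\<Sum>f\<in>F - {0}. \<alpha> (x - int (1 + q * n) *s f))"
      using assms(1,2) by (subst sum.remove[of F 0]) auto
    finally show ?thesis by (simp add: \<alpha>_def indicator_def of_bool_def)
  qed
  have "\<And>m i. a m i \<in> {0..1}"
  proof -
    fix m and i :: "(int ^ 'd) \<times> (int ^ 'd)"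
    obtain f x where i: "i = (f, x)" by (cases i)
    have "(\<Sum>n\<le>m. \<alpha> (x - int (1 + q * n) *s f)) \<le> real (card {..m}) * 1"
      by (rule sum_bounded_above) (simp add: \<alpha>_def)
    moreover have "(\<Sum>n\<le>m. \<alpha> (x - int (1 + q * n) *s f)) \<ge> 0"
      by (rule sum_nonneg) (simp add: \<alpha>_def)
    ultimately show "a m i \<in> {0..1}" by (simp add: i a_def)
  qed
  then obtain \<U> L where \<U>: "\<U> \<noteq> bot" "\<U> \<le> sequentially"
    and L: "\<And>i. L i \<in> {0..1}" "\<And>i. ((\<lambda>m. a m i) \<longlongrightarrow> L i) \<U>"
    by (rule simultaneous_limit_along_filter[of a]) blast

  have decomposition: "(\<Sum>f\<in>F - {0}. L (f, x)) = ?g x - indicator A x" for x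
  proof -
    have "(\<Sum>f\<in>F - {0}. a m (f, x)) = ?g x - indicator A x" for m
    proof -
      have "(\<Sum>f\<in>F - {0}. a m (f, x))
          = (\<Sum>n\<le>m. \<Sum>f\<in>F - {0}. \<alpha> (x - int (1 + q * n) *s f)) / real (Suc m)"
        unfolding a_def split_conv sum_divide_distrib[symmetric] by (subst sum.swap) (rule refl)
      also have "\<dots> = ?g x - indicator A x"
        unfolding sum_\<alpha> by simp
      finally show ?thesis .
    qed
    moreover have "((\<lambda>m. \<Sum>f\<in>F - {0}. a m (f, x)) \<longlongrightarrow> (\<Sum>f\<in>F - {0}. L (f, x))) \<U>"
      by (intro tendsto_sum L)
    ultimately show ?thesis
      using \<U>(1) by (simp add: tendsto_const_iff)
  qed

  have invariance: "L (f, x + int q *s f) = L (f, x)" for f x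
  proof -
    let ?e = "\<lambda>m. (\<alpha> (x + int q *s f - f) - \<alpha> (x - int (1 + q * m) *s f)) / real (Suc m)"
    \<comment> \<open>The translated average runs over the dilation factors \<open>1 + q (n - 1)\<close> for \<open>n \<le> m\<close>, so only its
      first term, with factor \<open>1 - q\<close>, and the last term of the original one do not cancel.\<close>
    have a_diff: "a m (f, x + int q *s f) - a m (f, x) = ?e m" for m
    proof -
      have shift: "x + int q *s f - int (1 + q * Suc n) *s f = x - int (1 + q * n) *s f" for n
        by (simp add: vec_eq_iff algebra_simps)
      have "(\<Sum>n\<le>m. \<alpha> (x + int q *s f - int (1 + q * n) *s f))
          - (\<Sum>n\<le>m. \<alpha> (x - int (1 + q * n) *s f))
          = \<alpha> (x + int q *s f - f) - \<alpha> (x - int (1 + q * m) *s f)"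
      proof (induction m)
        case (Suc m)
        show ?case unfolding sum.atMost_Suc shift using Suc by simp
      qed simp
      thus ?thesis by (simp only: a_def split_conv diff_divide_distrib[symmetric])
    qed
    have "?e \<longlonglongrightarrow> 0"
    proof (rule Lim_null_comparison)
      show "\<forall>\<^sub>F m in sequentially. norm (?e m) \<le> 1 / real (Suc m)"
        by (auto simp: \<alpha>_def divide_simps)
      show "(\<lambda>m. 1 / real (Suc m)) \<longlonglongrightarrow> 0"
        by (rule LIMSEQ_Suc[OF lim_const_over_n])
    qed
    hence "(?e \<longlongrightarrow> 0) \<U>"
      using \<U>(2) by (rule tendsto_mono[rotated])
    moreover have "(?e \<longlongrightarrow> L (f, x + int q *s f) - L (f, x)) \<U>"
      unfolding a_diff[symmetric] by (intro tendsto_diff L)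
    ultimately show ?thesis
      using tendsto_unique[OF \<U>(1)] by fastforce
  qed

  show ?thesis
  proof (intro exI[of _ "\<lambda>f x. L (f, x)"] conjI ballI allI)
    show "periodic (cyclic_subgroup (int q *s f)) (\<lambda>x. L (f, x))" for f
      by (rule periodic_cyclic_subgroupI) (rule invariance)
  qed (use L(1) decomposition in auto)
qed

end
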